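(* Let $k \geq 5$ be an integer and let $G$ be a finite connected graph that contains neither the path $P_k$ on $k$ vertices nor the claw $K_{1,3}$ as an induced subgraph. Then $c(G) \leq k-3$.
   Context: Cops and Robber game on a finite connected graph $G$: a player controlling $k$ cops places them on vertices (not necessarily distinct), then the robber is placed on a vertex; then the cops and the robber alternately move, each piece in its turn either moving to an adjacent vertex or staying put. The cops win if after finitely many rounds some cop occupies the same vertex as the robber; both sides have complete information. The cop number $c(G)$ is the minimum number of cops that can guarantee capture of the robber on $G$. $P_k$ denotes the path on $k$ vertices. *)

theory Defs
  imports "Graph_Theory.Graph_Theory"
begin

definition path_graph :: "nat \<Rightarrow> ('a, 'b) pre_digraph \<Rightarrow> bool" where
  "path_graph n G \<equiv> graph G \<and> (\<exists>p. distinct p \<and> length p = n \<and> verts G = set p \<and>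
     arcs_ends G = {(p ! i, p ! j) | i j. i < n \<and> j < n \<and> (j = Suc i \<or> i = Suc j)})"

definition piece_move :: "('a, 'b) pre_digraph \<Rightarrow> 'a \<Rightarrow> 'a \<Rightarrow> bool" where
  "piece_move G u v \<equiv> u \<in> verts G \<and> (v = u \<or> u \<rightarrow>\<^bsub>G\<^esub> v)"

definition robber_play :: "('a, 'b) pre_digraph \<Rightarrow> (nat \<Rightarrow> 'a) \<Rightarrow> bool" where
  "robber_play G r \<equiv> r 0 \<in> verts G \<and> (\<forall>n. piece_move G (r n) (r (Suc n)))"

text \<open>A position of \<open>k\<close> cops is a list of length \<open>k\<close>, its \<open>i\<close>-th entry being the vertex of
  the \<open>i\<close>-th cop; entries may coincide.\<close>

definition cops_play :: "('a, 'b) pre_digraph \<Rightarrow> nat \<Rightarrow> (nat \<Rightarrow> 'a list) \<Rightarrow> bool" where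
  "cops_play G k C \<equiv> length (C 0) = k \<and> set (C 0) \<subseteq> verts G \<and>
     (\<forall>n. list_all2 (piece_move G) (C n) (C (Suc n)))"

text \<open>The order of play is \<open>C 0, r 0, C 1, r 1, C 2, \<dots>\<close>: the robber may be caught by
  placing or moving him onto a cop (at \<open>C n, r n\<close>) or by a move of the cops
  (at \<open>C (Suc n), r n\<close>).\<close>

definition captured :: "(nat \<Rightarrow> 'a list) \<Rightarrow> (nat \<Rightarrow> 'a) \<Rightarrow> bool" where
  "captured C r \<equiv> \<exists>n. r n \<in> set (C n) \<or> r n \<in> set (C (Suc n))"

text \<open>A strategy \<open>\<sigma>\<close> of the cops maps the list of all robber positions so far to the next position
  of the cops. The cops' own past positions are determined by \<open>\<sigma>\<close> and the robber's past positions,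
  so this is complete information. Quantifying over all robber plays covers every
  robber strategy. Plays are continued forever after a capture, which is harmless because
  every piece may stay put.\<close>

definition cops_win :: "('a, 'b) pre_digraph \<Rightarrow> nat \<Rightarrow> bool" where
  "cops_win G k \<equiv> \<exists>\<sigma> :: 'a list \<Rightarrow> 'a list. \<forall>r. robber_play G r \<longrightarrow>
     cops_play G k (\<lambda>n. \<sigma> (map r [0..<n])) \<and> captured (\<lambda>n. \<sigma> (map r [0..<n])) r"

definition cop_number :: "('a, 'b) pre_digraph \<Rightarrow> nat" where
  "cop_number G \<equiv> LEAST k. cops_win G k"

text \<open>The minimum in \<open>cop_number\<close> is attained on finite graphs.\<close>

lemma cops_win_card_verts:
  assumes "finite (verts G)"
  shows "cops_win G (card (verts G))"
proof -
  obtain vs where vs: "set vs = verts G" "distinct vs"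
    using finite_distinct_list[OF assms] by blast
  have "list_all2 (piece_move G) vs vs"
    by (auto simp: list_all2_conv_all_nth piece_move_def vs(1)[symmetric])
  then show ?thesis
    unfolding cops_win_def cops_play_def captured_def robber_play_def
    using vs by (intro exI[of _ "\<lambda>_. vs"]) (auto simp: distinct_card[symmetric])
qed

lemma cops_win_cop_number:
  assumes "finite (verts G)"
  shows "cops_win G (cop_number G)"
  unfolding cop_number_def using cops_win_card_verts[OF assms] by (rule LeastI)

end

theory Submission
  imports Defs
begin

text \<open>If \<open>G\<close> contains an induced cycle \<open>C\<^sub>k\<close>, claw- and \<open>P\<^sub>k\<close>-freeness force every vertex outside
  it to have at least three neighbours on it, each next to another one; hence the cycle, and even
  a suitable set of \<open>k - 3\<close> of its vertices, dominates \<open>G\<close>. Otherwise \<open>k - 3\<close> cops build an induced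
  path towards the robber as in Gyarfas's argument. When all of them are in place, the path
  shifts by one vertex towards the robber: staying away from it would give an induced \<open>P\<^sub>k\<close>,
  escaping around its tail end an induced \<open>C\<^sub>k\<close>.\<close>

section \<open>Winning positions\<close>

text \<open>The cops are to move.\<close>

inductive cop_wins :: "('a, 'b) pre_digraph \<Rightarrow> 'a list \<Rightarrow> 'a \<Rightarrow> bool" for G where
  capture: "list_all2 (piece_move G) C C' \<Longrightarrow> r \<in> set C' \<Longrightarrow> cop_wins G C r"
| advance: "list_all2 (piece_move G) C C' \<Longrightarrow>
    (\<And>r'. piece_move G r r' \<Longrightarrow> cop_wins G C' r') \<Longrightarrow> cop_wins G C r"

lemma list_all2_piece_move_refl:
  "set C \<subseteq> verts G \<Longrightarrow> list_all2 (piece_move G) C C"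
  by (auto simp: list_all2_conv_all_nth piece_move_def)

definition cop_moves :: "('a, 'b) pre_digraph \<Rightarrow> (nat \<Rightarrow> 'a list) \<Rightarrow> bool" where
  "cop_moves G C \<longleftrightarrow> (\<forall>n. list_all2 (piece_move G) (C n) (C (Suc n)))"

lemma robber_play_shift: "robber_play G r \<Longrightarrow> robber_play G (\<lambda>n. r (Suc n))"
  unfolding robber_play_def piece_move_def by blast

lemma map_upt_shift: "map r [0..<Suc n] = r 0 # map (\<lambda>n. r (Suc n)) [0..<n]"
  by (simp add: map_upt_Suc del: upt_Suc)

text \<open>The robber's first vertex is fixed, so that strategies against his different answers can
  be built separately and then glued.\<close>

definition wins_from :: "('a, 'b) pre_digraph \<Rightarrow> ('a list \<Rightarrow> 'a list) \<Rightarrow> 'a \<Rightarrow> bool" where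
  "wins_from G \<sigma> r0 \<longleftrightarrow> (\<forall>r. robber_play G r \<longrightarrow> r 0 = r0 \<longrightarrow>
     cop_moves G (\<lambda>n. \<sigma> (map r [0..<n])) \<and> captured (\<lambda>n. \<sigma> (map r [0..<n])) r)"

lemma (in wf_digraph) piece_moves_in_verts:
  assumes "list_all2 (piece_move G) C C'"
  shows "set C' \<subseteq> verts G"
proof
  fix x assume "x \<in> set C'"
  then obtain i where "i < length C'" "x = C' ! i" by (auto simp: in_set_conv_nth)
  then have "piece_move G (C ! i) x" using assms by (simp add: list_all2_conv_all_nth)
  then show "x \<in> verts G" by (auto simp: piece_move_def)
qed

text \<open>Induction on \<open>cop_wins\<close>. In the case \<open>advance\<close> a strategy is
  chosen for each answer of the robber; the glued one drops the oldest entry of the history and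
  consults the strategy belonging to the next.\<close>

lemma (in wf_digraph) cop_wins_strategy:
  assumes "cop_wins G C r0" "set C \<subseteq> verts G"
  shows "\<exists>\<sigma>. \<sigma> [] = C \<and> wins_from G \<sigma> r0"
  using assms
proof (induction rule: cop_wins.induct)
  case (capture C C' r0)
  let ?s = "\<lambda>h. if h = [] then C else C'"
  have "wins_from G ?s r0"
    unfolding wins_from_def
  proof (intro allI impI conjI)
    fix r assume r: "robber_play G r" "r 0 = r0"
    show "cop_moves G (\<lambda>n. ?s (map r [0..<n]))"
      using capture list_all2_piece_move_refl[OF piece_moves_in_verts[OF capture(1)]]
      by (simp add: cop_moves_def)
    show "captured (\<lambda>n. ?s (map r [0..<n])) r"
      using capture r unfolding captured_def by (intro exI[of _ 0]) simp
  qed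
  then show ?case by (intro exI[of _ ?s]) simp
next
  case (advance C C' r0)
  have "\<forall>r'. \<exists>\<sigma>. piece_move G r0 r' \<longrightarrow> \<sigma> [] = C' \<and> wins_from G \<sigma> r'"
    using advance.IH piece_moves_in_verts[OF advance(1)] by blast
  then have "\<exists>F. \<forall>r'. piece_move G r0 r' \<longrightarrow> F r' [] = C' \<and> wins_from G (F r') r'"
    by (rule choice)
  then obtain F where F: "\<And>r'. piece_move G r0 r' \<Longrightarrow> F r' [] = C'"
    "\<And>r'. piece_move G r0 r' \<Longrightarrow> wins_from G (F r') r'"
    by blast
  \<comment> \<open>For \<open>t = []\<close> the robber's answer is still unknown, but every
    \<open>F r'\<close> starts from the same \<open>C'\<close>.\<close>
  let ?s = "\<lambda>h. case h of [] \<Rightarrow> C | _ # t \<Rightarrow> (if t = [] then C' else F (hd t) t)"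
  have "wins_from G ?s r0"
    unfolding wins_from_def
  proof (intro allI impI)
    fix r assume r: "robber_play G r" "r 0 = r0"
    define q where "q = (\<lambda>n. r (Suc n))"
    have mv: "piece_move G r0 (q 0)" using r by (auto simp: robber_play_def q_def)
    have q: "robber_play G q" unfolding q_def using r(1) by (rule robber_play_shift)
    have s: "?s (map r [0..<Suc n]) = F (q 0) (map q [0..<n])" for n
    proof -
      have "?s (r 0 # map q [0..<n]) = F (q 0) (map q [0..<n])"
        using F(1)[OF mv] by (cases n) (simp_all add: hd_map upt_conv_Cons del: upt_Suc)
      then show ?thesis by (simp only: map_upt_shift q_def)
    qed
    have Fq: "cop_moves G (\<lambda>n. F (q 0) (map q [0..<n]))" "captured (\<lambda>n. F (q 0) (map q [0..<n])) q"
      using F(2)[OF mv] q by (auto simp: wins_from_def)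
    have "list_all2 (piece_move G) (?s (map r [0..<n])) (?s (map r [0..<Suc n]))" for n
    proof (cases n)
      case 0
      then show ?thesis using advance(1) by simp
    next
      case (Suc m)
      show ?thesis unfolding Suc s using Fq(1) by (simp only: cop_moves_def)
    qed
    then have "cop_moves G (\<lambda>n. ?s (map r [0..<n]))" unfolding cop_moves_def by blast
    moreover obtain n where "q n \<in> set (F (q 0) (map q [0..<n])) \<or>
        q n \<in> set (F (q 0) (map q [0..<Suc n]))"
      using Fq(2) unfolding captured_def by blast
    then have "r (Suc n) \<in> set (?s (map r [0..<Suc n])) \<or> r (Suc n) \<in> set (?s (map r [0..<Suc (Suc n)]))"
      unfolding s unfolding q_def .
    then have "captured (\<lambda>n. ?s (map r [0..<n])) r" unfolding captured_def by blast
    ultimately show "cop_moves G (\<lambda>n. ?s (map r [0..<n])) \<and> captured (\<lambda>n. ?s (map r [0..<n])) r" ..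
  qed
  then show ?case by (intro exI[of _ ?s]) simp
qed

text \<open>The cops are placed before the robber, hence one \<open>C\<close> for all
  \<open>r\<close>; only later positions depend on his first vertex, read off as
  \<open>hd h\<close>.\<close>

lemma (in wf_digraph) cops_winI:
  assumes "set C \<subseteq> verts G" "\<And>r. r \<in> verts G \<Longrightarrow> cop_wins G C r"
  shows "cops_win G (length C)"
proof -
  have "\<forall>r0. \<exists>\<sigma>. r0 \<in> verts G \<longrightarrow> \<sigma> [] = C \<and> wins_from G \<sigma> r0"
    using cop_wins_strategy assms by blast
  then have "\<exists>F. \<forall>r0. r0 \<in> verts G \<longrightarrow> F r0 [] = C \<and> wins_from G (F r0) r0"
    by (rule choice)
  then obtain F where F: "\<And>r0. r0 \<in> verts G \<Longrightarrow> F r0 [] = C"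
    "\<And>r0. r0 \<in> verts G \<Longrightarrow> wins_from G (F r0) r0"
    by blast
  let ?s = "\<lambda>h. if h = [] then C else F (hd h) h"
  have "cops_play G (length C) (\<lambda>n. ?s (map r [0..<n])) \<and> captured (\<lambda>n. ?s (map r [0..<n])) r"
    if r: "robber_play G r" for r
  proof -
    have r0: "r 0 \<in> verts G" using r by (simp add: robber_play_def)
    have s: "?s (map r [0..<n]) = F (r 0) (map r [0..<n])" for n
      using F(1)[OF r0] by (cases n) (simp_all add: hd_map upt_conv_Cons del: upt_Suc)
    show ?thesis unfolding s using F(1)[OF r0] F(2)[OF r0] r assms(1)
      by (simp add: cops_play_def cop_moves_def wins_from_def)
  qed
  then show ?thesis unfolding cops_win_def by (intro exI[of _ ?s]) blast
qed

section \<open>Induced paths, cycles and claws\<close>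

definition closed_nbhd :: "('a, 'b) pre_digraph \<Rightarrow> 'a set \<Rightarrow> 'a set" where
  "closed_nbhd G S = S \<union> {v. \<exists>u\<in>S. u \<rightarrow>\<^bsub>G\<^esub> v}"

text \<open>Adjacency in \<open>G - S\<close>. The reflexive transitive closure encodes lying in one
  component of \<open>G - S\<close>, but also relates each vertex of \<open>S\<close> to
  itself.\<close>

definition avoiding :: "('a, 'b) pre_digraph \<Rightarrow> 'a set \<Rightarrow> 'a rel" where
  "avoiding G S = {(x, y) \<in> arcs_ends G. x \<notin> S \<and> y \<notin> S}"

definition induced_path :: "('a, 'b) pre_digraph \<Rightarrow> 'a list \<Rightarrow> bool" where
  "induced_path G p \<longleftrightarrow> distinct p \<and> set p \<subseteq> verts G \<and>
     (\<forall>i<length p. \<forall>j<length p. (p ! i, p ! j) \<in> arcs_ends G \<longleftrightarrow> j = Suc i \<or> i = Suc j)"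

text \<open>The cycle is presented as a function of period \<open>k\<close>, so that rotations are shifts of
  the argument.\<close>

definition induced_cycle :: "('a, 'b) pre_digraph \<Rightarrow> nat \<Rightarrow> (nat \<Rightarrow> 'a) \<Rightarrow> bool" where
  "induced_cycle G k c \<longleftrightarrow> range c \<subseteq> verts G \<and>
     (\<forall>i j. c i = c j \<longleftrightarrow> i mod k = j mod k) \<and>
     (\<forall>i j. c i \<rightarrow>\<^bsub>G\<^esub> c j \<longleftrightarrow> j mod k = Suc i mod k \<or> i mod k = Suc j mod k)"

section \<open>Closed neighbourhoods and walks that avoid them\<close>

lemma closed_nbhd_Un: "closed_nbhd G (S \<union> T) = closed_nbhd G S \<union> closed_nbhd G T"
  by (auto simp: closed_nbhd_def)

lemma closed_nbhd_mono: "S \<subseteq> T \<Longrightarrow> closed_nbhd G S \<subseteq> closed_nbhd G T"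
  by (auto simp: closed_nbhd_def)

lemma avoiding_rtrancl_notin:
  "(y, r) \<in> (avoiding G S)\<^sup>* \<Longrightarrow> r \<notin> S \<Longrightarrow> y \<notin> S"
  by (erule converse_rtranclE) (auto simp: avoiding_def)

text \<open>Take \<open>a\<close> as the last vertex of \<open>T\<close> on the walk and
  \<open>b\<close> as its successor; since a step of \<open>avoiding G S\<close> leaves
  \<open>a\<close>, it lies outside \<open>S\<close>.\<close>

lemma avoiding_boundary:
  assumes "(y, r) \<in> (avoiding G S)\<^sup>*" "r \<notin> S \<union> T" "y \<in> T"
  obtains a b where "a \<in> T" "a \<notin> S" "a \<rightarrow>\<^bsub>G\<^esub> b" "(b, r) \<in> (avoiding G (S \<union> T))\<^sup>*"
proof -
  \<comment> \<open>The first disjunct is there for the induction; \<open>y \<in> T\<close> rules it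
    out in the end.\<close>
  have "(y, r) \<in> (avoiding G (S \<union> T))\<^sup>* \<or>
     (\<exists>a b. a \<in> T \<and> a \<notin> S \<and> a \<rightarrow>\<^bsub>G\<^esub> b \<and> (b, r) \<in> (avoiding G (S \<union> T))\<^sup>*)"
    using assms(1)
  proof (induction rule: converse_rtrancl_induct)
    case (step x y)
    show ?case
    proof (cases "(y, r) \<in> (avoiding G (S \<union> T))\<^sup>*")
      case True
      note y = avoiding_rtrancl_notin[OF True assms(2)]
      show ?thesis
      proof (cases "x \<in> T")
        case True
        with \<open>(y, r) \<in> (avoiding G (S \<union> T))\<^sup>*\<close> step(1) show ?thesis by (auto simp: avoiding_def)
      next
        case False
        with y step(1) have "(x, y) \<in> avoiding G (S \<union> T)" by (auto simp: avoiding_def)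
        with True show ?thesis by (meson converse_rtrancl_into_rtrancl)
      qed
    qed (use step in blast)
  qed simp
  with that assms show thesis using avoiding_rtrancl_notin[of y r G "S \<union> T"] by blast
qed

lemma mod_add_left_cancel_nat: "(s + i) mod k = (s + j) mod k \<longleftrightarrow> i mod k = j mod k" for k :: nat
proof -
  have "(s + i) mod k = (s + j) mod k \<longleftrightarrow> i mod k = j mod k" if "i \<le> j" for i j
    using mod_eq_dvd_iff_nat[of "s + i" "s + j" k] mod_eq_dvd_iff_nat[of i j k] that
    by (auto simp: eq_commute)
  from this[of i j] this[of j i] show ?thesis by (metis nat_le_linear)
qed

context graph
begin

lemma closed_nbhd_iff: "v \<in> closed_nbhd G S \<longleftrightarrow> v \<in> S \<or> (\<exists>u\<in>S. u \<rightarrow> v)"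
  by (auto simp: closed_nbhd_def)

lemma adj_sym: "u \<rightarrow> v \<longleftrightarrow> v \<rightarrow> u"
  using sym_arcs by (auto simp: symmetric_def sym_def)

lemma adj_irrefl: "\<not> v \<rightarrow> v"
  using no_loops by (auto simp: arcs_ends_def arc_to_ends_def)

lemma arcs_ends_induce: "arcs_ends (G \<restriction> S) = {(u, v). u \<rightarrow> v \<and> u \<in> S \<and> v \<in> S}"
  by (auto simp: arcs_ends_def arc_to_ends_def induce_subgraph_def image_iff)

lemma graph_induce:
  assumes "S \<subseteq> verts G"
  shows "graph (G \<restriction> S)"
proof (rule digraph.graphI)
  have ind: "induced_subgraph (G \<restriction> S) G" using assms by (rule induced_induce)
  then show "digraph (G \<restriction> S)"
    by (intro digraph_subgraph) (simp add: induced_subgraph_def)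
  show "symmetric (G \<restriction> S)"
    using sym_arcs ind by (rule induced_graph_imp_symmetric)
qed

lemma induced_path_imp_path_graph:
  assumes "induced_path G p"
  shows "\<exists>H. induced_subgraph H G \<and> path_graph (length p) H"
proof (intro exI conjI)
  have S: "set p \<subseteq> verts G" and d: "distinct p"
    using assms by (simp_all add: induced_path_def)
  show "induced_subgraph (G \<restriction> set p) G" using S by (rule induced_induce)
  let ?A = "{(p ! i, p ! j) | i j. i < length p \<and> j < length p \<and> (j = Suc i \<or> i = Suc j)}"
  have "(u, v) \<in> arcs_ends (G \<restriction> set p) \<longleftrightarrow> (u, v) \<in> ?A" for u v
  proof
    assume "(u, v) \<in> arcs_ends (G \<restriction> set p)"
    then have "(u, v) \<in> arcs_ends G" "u \<in> set p" "v \<in> set p" by (simp_all add: arcs_ends_induce)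
    moreover then obtain i j where "i < length p" "u = p ! i" "j < length p" "v = p ! j"
      by (metis in_set_conv_nth)
    ultimately show "(u, v) \<in> ?A" using assms unfolding induced_path_def by blast
  next
    assume "(u, v) \<in> ?A"
    then show "(u, v) \<in> arcs_ends (G \<restriction> set p)"
      using assms unfolding arcs_ends_induce induced_path_def by auto
  qed
  then have "arcs_ends (G \<restriction> set p) = ?A" by (intro set_eqI) (simp only: split_paired_all)
  then show "path_graph (length p) (G \<restriction> set p)"
    using graph_induce[OF S] d unfolding path_graph_def
    by - (rule conjI, assumption, rule exI[of _ p], simp)
qed

lemma claw_imp_complete_bipartite:
  assumes "v \<rightarrow> a" "v \<rightarrow> b" "v \<rightarrow> c" "a \<noteq> b" "a \<noteq> c" "b \<noteq> c" "\<not> a \<rightarrow> b" "\<not> a \<rightarrow> c" "\<not> b \<rightarrow> c"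
  shows "\<exists>H. induced_subgraph H G \<and> complete_bipartite_digraph 1 3 H"
proof (intro exI conjI)
  let ?S = "{v} \<union> {a, b, c}"
  have S: "?S \<subseteq> verts G" using assms(1-3) by auto
  show "induced_subgraph (G \<restriction> ?S) G" using S by (rule induced_induce)
  have ne: "v \<noteq> a" "v \<noteq> b" "v \<noteq> c" using assms adj_irrefl by auto
  have "arcs_ends (G \<restriction> ?S) = {v} \<times> {a, b, c} \<union> {a, b, c} \<times> {v}"
    using assms adj_irrefl unfolding arcs_ends_induce by (auto simp: adj_sym)
  moreover have "card {a, b, c} = 3" using assms by simp
  ultimately show "complete_bipartite_digraph 1 3 (G \<restriction> ?S)"
    using graph_induce[OF S] ne unfolding complete_bipartite_digraph_def
    by - (rule conjI, blast, rule exI[of _ "{v}"], rule exI[of _ "{a, b, c}"], simp)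
qed

lemma induced_path_Cons:
  assumes "induced_path G (u # p)" "v \<rightarrow> u" "\<And>x. x \<in> set p \<Longrightarrow> v \<noteq> x \<and> \<not> v \<rightarrow> x"
  shows "induced_path G (v # u # p)"
  unfolding induced_path_def
proof (intro conjI allI impI)
  show "distinct (v # u # p)" "set (v # u # p) \<subseteq> verts G"
    using assms adj_irrefl by (auto simp: induced_path_def)
  fix i j assume ij: "i < length (v # u # p)" "j < length (v # u # p)"
  have v: "(v, (u # p) ! l) \<in> arcs_ends G \<longleftrightarrow> l = 0" if "l < Suc (length p)" for l
    using that assms by (cases l) auto
  then have v': "((u # p) ! l, v) \<in> arcs_ends G \<longleftrightarrow> l = 0" if "l < Suc (length p)" for l
    using that adj_sym by blast
  have "((u # p) ! l, (u # p) ! m) \<in> arcs_ends G \<longleftrightarrow> m = Suc l \<or> l = Suc m"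
    if "l < Suc (length p)" "m < Suc (length p)" for l m
    using assms(1) that by (auto simp: induced_path_def)
  with v ij show "((v # u # p) ! i, (v # u # p) ! j) \<in> arcs_ends G \<longleftrightarrow> j = Suc i \<or> i = Suc j"
    using v'
    by (cases i; cases j) (simp_all add: adj_irrefl)
qed

lemma induced_cycleI:
  assumes "induced_path G p" "x \<in> verts G" "x \<notin> set p" "length p \<ge> 2"
    "\<And>i. i < length p \<Longrightarrow> (x, p ! i) \<in> arcs_ends G \<longleftrightarrow> i = 0 \<or> Suc i = length p"
  shows "induced_cycle G (Suc (length p)) (\<lambda>i. (x # p) ! (i mod Suc (length p)))"
proof -
  let ?k = "Suc (length p)"
  have d: "distinct (x # p)" "set (x # p) \<subseteq> verts G"
    using assms by (auto simp: induced_path_def)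
  have inj: "(x # p) ! i = (x # p) ! j \<longleftrightarrow> i = j" if "i < ?k" "j < ?k" for i j
    using nth_eq_iff_index_eq[OF d(1)] that by simp
  have adj: "((x # p) ! i, (x # p) ! j) \<in> arcs_ends G \<longleftrightarrow> j = Suc i mod ?k \<or> i = Suc j mod ?k"
    if "i < ?k" "j < ?k" for i j
  proof -
    have "Suc i mod ?k = (if Suc i = ?k then 0 else Suc i)" 
         "Suc j mod ?k = (if Suc j = ?k then 0 else Suc j)"
      using that by auto
    moreover have "(p ! l, p ! m) \<in> arcs_ends G \<longleftrightarrow> m = Suc l \<or> l = Suc m"
      if "l < length p" "m < length p" for l m
      using assms(1) that by (auto simp: induced_path_def)
    moreover have "(p ! l, x) \<in> arcs_ends G \<longleftrightarrow> l = 0 \<or> Suc l = length p" if "l < length p" for l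
      using assms(5)[OF that] adj_sym by blast
    ultimately show ?thesis
      using assms(4,5) that
      by (cases i; cases j) (auto simp: adj_irrefl)
  qed
  have "(x # p) ! (i mod ?k) \<in> verts G" for i
    using d(2) nth_mem[of "i mod ?k" "x # p"] by (metis length_Cons mod_less_divisor subsetD zero_less_Suc)
  then show ?thesis
    unfolding induced_cycle_def by (auto simp: inj adj mod_Suc_eq simp del: nth_Cons_Suc)
qed

lemma claw_free_adj:
  assumes "\<not> (\<exists>H. induced_subgraph H G \<and> complete_bipartite_digraph 1 3 H)"
    "v \<rightarrow> a" "v \<rightarrow> b" "v \<rightarrow> c" "a \<noteq> b" "a \<noteq> c" "b \<noteq> c"
  shows "a \<rightarrow> b \<or> a \<rightarrow> c \<or> b \<rightarrow> c"
  using claw_imp_complete_bipartite[OF assms(2-7)] assms(1) by blast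

lemma cop_wins_near:
  assumes "set C \<subseteq> verts G" "r \<in> closed_nbhd G (set C)"
  shows "cop_wins G C r"
proof -
  obtain u where u: "u \<in> set C" "u = r \<or> u \<rightarrow> r"
    using assms(2) by (auto simp: closed_nbhd_iff)
  then obtain i where i: "i < length C" "C ! i = u" by (auto simp: in_set_conv_nth)
  have "list_all2 (piece_move G) C (C[i := r])"
    using assms(1) u i by (auto simp: list_all2_conv_all_nth piece_move_def nth_list_update)
  moreover have "r \<in> set (C[i := r])" using i by (simp add: set_update_memI)
  ultimately show ?thesis by (rule cop_wins.capture)
qed

section \<open>Chasing with an induced path of cops\<close>

text \<open>The cops occupy the induced path \<open>us\<close>, newest vertex first. The neighbour \<open>w\<close> of its
  head prolongs the path into the component of \<open>G - N[us]\<close> that contains the robber at \<open>r\<close>.\<close>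

definition heads_for :: "'a \<Rightarrow> 'a list \<Rightarrow> 'a \<Rightarrow> bool" where
  "heads_for w us r \<longleftrightarrow> induced_path G us \<and> us \<noteq> [] \<and> r \<in> verts G \<and>
     r \<notin> closed_nbhd G (set us) \<and> w \<rightarrow> hd us \<and> (\<forall>x\<in>set (tl us). w \<noteq> x \<and> \<not> w \<rightarrow> x) \<and>
     (\<exists>y. w \<rightarrow> y \<and> (y, r) \<in> (avoiding G (closed_nbhd G (set us)))\<^sup>*)"

lemma heads_for_path: "heads_for w us r \<Longrightarrow> induced_path G (w # us)"
  unfolding heads_for_def by (cases us) (auto intro: induced_path_Cons)

lemma heads_for_in_nbhd: "heads_for w us r \<Longrightarrow> w \<in> closed_nbhd G (set us)"
  unfolding heads_for_def closed_nbhd_iff using adj_sym[of w "hd us"] hd_in_set by blast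

text \<open>A robber who does not enter \<open>N[us]\<close> stays in his component of
  \<open>G - N[us]\<close>, so the same \<open>w\<close> still leads to him.\<close>

lemma heads_for_move:
  assumes "heads_for w us r" "piece_move G r r'" "r' \<notin> closed_nbhd G (set us)"
  shows "heads_for w us r'"
proof (cases "r' = r")
  case False
  then have "r \<rightarrow> r'" using assms(2) by (auto simp: piece_move_def)
  then have "(r, r') \<in> avoiding G (closed_nbhd G (set us))" "r' \<in> verts G"
    using assms by (auto simp: avoiding_def heads_for_def)
  then show ?thesis using assms unfolding heads_for_def by (meson rtrancl.rtrancl_into_rtrancl)
qed (use assms in simp)

text \<open>On the walk from \<open>y\<close> to \<open>r\<close> in \<open>G - N[us]\<close>, the
  last vertex in \<open>N[w]\<close> serves as \<open>w'\<close>: it sees \<open>w\<close> but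
  nothing in \<open>us\<close>, and its successor lies in the robber's component once
  \<open>N[w]\<close> is removed too.\<close>

lemma heads_for_extend:
  assumes "heads_for w us r" "r \<notin> closed_nbhd G {w}"
  obtains w' where "heads_for w' (w # us) r"
proof -
  let ?S = "closed_nbhd G (set us)" and ?T = "closed_nbhd G {w}"
  have U: "closed_nbhd G (set (w # us)) = ?S \<union> ?T"
    using closed_nbhd_Un[of G "set us" "{w}"] by simp
  obtain y where y: "w \<rightarrow> y" "(y, r) \<in> (avoiding G ?S)\<^sup>*"
    using assms(1) unfolding heads_for_def by blast
  have r: "r \<notin> ?S \<union> ?T" using assms unfolding heads_for_def by blast
  have "y \<in> ?T" using y(1) by (auto simp: closed_nbhd_iff)
  with y(2) r obtain a b where ab: "a \<in> ?T" "a \<notin> ?S" "a \<rightarrow> b" "(b, r) \<in> (avoiding G (?S \<union> ?T))\<^sup>*"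
    by (rule avoiding_boundary)
  \<comment> \<open>\<open>w\<close> is dominated by \<open>us\<close>, while \<open>a\<close> is
    not.\<close>
  have "a \<noteq> w" using heads_for_in_nbhd[OF assms(1)] ab(2) by blast
  then have "a \<rightarrow> w" using ab(1) adj_sym by (auto simp: closed_nbhd_iff)
  moreover have "a \<noteq> x \<and> \<not> a \<rightarrow> x" if "x \<in> set us" for x
    using ab(2) that adj_sym by (auto simp: closed_nbhd_iff)
  ultimately have "heads_for a (w # us) r"
    unfolding heads_for_def U using heads_for_path[OF assms(1)] assms(1) r ab
    by (auto simp: heads_for_def)
  then show thesis by (rule that)
qed

text \<open>Otherwise two further extensions of \<open>w # us\<close> give too long an induced path.\<close>

lemma heads_for_adj:
  assumes "heads_for w us r" "\<And>p. induced_path G p \<Longrightarrow> length p \<noteq> length us + 3"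
  shows "w \<rightarrow> r"
proof (rule ccontr)
  assume "\<not> w \<rightarrow> r"
  moreover have "w \<noteq> r"
    using heads_for_in_nbhd[OF assms(1)] assms(1) by (auto simp: heads_for_def)
  ultimately have "r \<notin> closed_nbhd G {w}" by (auto simp: closed_nbhd_iff)
  with assms(1) obtain w' where w': "heads_for w' (w # us) r" by (rule heads_for_extend)
  let ?S = "closed_nbhd G (set (w # us))"
  obtain y where y: "w' \<rightarrow> y" "(y, r) \<in> (avoiding G ?S)\<^sup>*" and r: "r \<notin> ?S"
    using w' unfolding heads_for_def by blast
  \<comment> \<open>The second extension is \<open>y\<close> itself: lying in the robber's
    component, it sees nothing in \<open>w # us\<close>.\<close>
  have "y \<notin> ?S" using avoiding_rtrancl_notin[OF y(2) r] .
  then have "y \<noteq> x \<and> \<not> y \<rightarrow> x" if "x \<in> set (w # us)" for x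
    using that adj_sym by (auto simp: closed_nbhd_iff)
  then have "induced_path G (y # w' # w # us)"
    using heads_for_path[OF w'] y(1) adj_sym by (blast intro: induced_path_Cons)
  then show False using assms(2) by fastforce
qed

text \<open>The whole path shifts by one step onto \<open>w\<close>. The only vertices this stops dominating are
  neighbours of the tail end, and a robber escaping there closes an induced cycle.\<close>

lemma shift_path_wins:
  assumes "heads_for w us r"
    and no_path: "\<And>p. induced_path G p \<Longrightarrow> length p \<noteq> length us + 3"
    and no_cycle: "\<And>c. \<not> induced_cycle G (length us + 3) c"
  shows "cop_wins G (rev us) r"
proof -
  note path = heads_for_path[OF assms(1)]
  have us: "set us \<subseteq> verts G" "us \<noteq> []" "w \<in> verts G" "w \<rightarrow> hd us" "r \<in> verts G"
      "r \<notin> closed_nbhd G (set us)"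
    using assms(1) path by (auto simp: heads_for_def induced_path_def)
  have wr: "w \<rightarrow> r" using heads_for_adj[OF assms(1) no_path] .
  \<comment> \<open>The cop at the head of \<open>us\<close> moves to \<open>w\<close>, every other
    cop to the place of the one ahead, and \<open>last us\<close> is vacated.\<close>
  let ?C = "rev (w # butlast us)"
  have C: "set ?C \<subseteq> verts G" using us by (auto dest: in_set_butlastD)
  have "piece_move G (us ! i) ((w # butlast us) ! i)" if "i < length us" for i
  proof (cases i)
    case 0
    then show ?thesis using us adj_sym[of w] by (auto simp: piece_move_def hd_conv_nth)
  next
    case (Suc l)
    have "((w # us) ! (Suc i), (w # us) ! i) \<in> arcs_ends G"
      using path that unfolding induced_path_def by (metis Suc_mono length_Cons less_SucI)
    moreover have "(w # butlast us) ! i = (w # us) ! i" using Suc that by (simp add: nth_butlast)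
    moreover have "us ! i \<in> verts G" using us(1) nth_mem[OF that] by blast
    ultimately show ?thesis unfolding piece_move_def by simp
  qed
  then have "list_all2 (piece_move G) us (w # butlast us)"
    using us by (simp add: list_all2_conv_all_nth)
  then have moves: "list_all2 (piece_move G) (rev us) ?C"
    by (simp only: list_all2_rev)
  have "cop_wins G ?C r'" if r': "piece_move G r r'" for r'
  proof (cases "r' \<in> closed_nbhd G (set ?C)")
    case True
    with C show ?thesis by (rule cop_wins_near)
  next
    case False
    have r'V: "r' \<in> verts G" using r' us(5) by (auto simp: piece_move_def)
    have far: "r' \<noteq> x \<and> \<not> r' \<rightarrow> x" if "x = w \<or> x \<in> set (butlast us)" for x
      using False that adj_sym by (auto simp: closed_nbhd_iff)
    \<comment> \<open>Outside \<open>N[us]\<close> the robber would still be in the component ahead,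
      hence next to \<open>w\<close>, which is now occupied.\<close>
    have "r' \<in> closed_nbhd G (set us)"
    proof (rule ccontr)
      assume "r' \<notin> closed_nbhd G (set us)"
      then have "w \<rightarrow> r'"
        using heads_for_adj[OF heads_for_move[OF assms(1) r'] no_path] by blast
      then show False using far adj_sym by blast
    qed
    then obtain u where u: "u \<in> set us" "r' = u \<or> u \<rightarrow> r'" by (auto simp: closed_nbhd_iff)
    have rr': "r \<rightarrow> r'"
      using r' us(6) \<open>r' \<in> closed_nbhd G (set us)\<close> by (auto simp: piece_move_def)
    have "set us = insert (last us) (set (butlast us))"
      using us(2) by (metis append_butlast_last_id set_append list.simps(15) list.set(1) Un_insert_right sup_bot_right)
    then have "u = last us" using u far adj_sym by blast
    moreover have "r' \<notin> set us"
      using rr' us(6) adj_sym by (auto simp: closed_nbhd_iff)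
    ultimately have last: "r' \<rightarrow> last us" using u adj_sym by blast
    \<comment> \<open>This path has \<open>length us + 2\<close> vertices, and \<open>r'\<close> is
      adjacent to exactly its two ends, which closes a cycle of the forbidden length.\<close>
    have "induced_path G (r # w # us)"
      using path wr adj_sym us(6) by (intro induced_path_Cons) (auto simp: closed_nbhd_iff)
    moreover have "r' \<notin> set (r # w # us)"
      using \<open>r' \<notin> set us\<close> far rr' adj_irrefl by auto
    moreover have "(r', (r # w # us) ! i) \<in> arcs_ends G \<longleftrightarrow> i = 0 \<or> Suc i = length (r # w # us)"
      if i: "i < length (r # w # us)" for i
    proof (cases i)
      case 0
      then show ?thesis using rr' adj_sym by simp
    next
      case (Suc l)
      show ?thesis
      proof (cases l)
        case 0
        then show ?thesis using far Suc us(2) by simp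
      next
        case (Suc m)
        show ?thesis
        proof (cases "Suc m = length us")
          case True
          then show ?thesis using last us(2) \<open>i = Suc l\<close> Suc by (auto simp: last_conv_nth simp flip: True)
        next
          case False
          then have "m < length (butlast us)" using i \<open>i = Suc l\<close> Suc by simp
          then have "us ! m \<in> set (butlast us)" by (metis nth_butlast nth_mem)
          then show ?thesis using far False \<open>i = Suc l\<close> Suc by simp
        qed
      qed
    qed
    ultimately have "induced_cycle G (Suc (length (r # w # us)))
        (\<lambda>i. (r' # r # w # us) ! (i mod Suc (length (r # w # us))))"
      using r'V by (intro induced_cycleI) simp_all
    moreover have "Suc (length (r # w # us)) = length us + 3" by simp
    ultimately have "induced_cycle G (length us + 3)
        (\<lambda>i. (r' # r # w # us) ! (i mod (length us + 3)))"
      by (simp only:)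
    then show ?thesis using no_cycle by blast
  qed
  with moves show ?thesis by (rule cop_wins.advance)
qed

text \<open>One idle cop walks from \<open>f\<close> to \<open>w\<close> while the cops on
  \<open>us\<close> stand still. A robber entering \<open>N[us]\<close> is caught; otherwise
  \<open>heads_for w us\<close> persists throughout the walk.\<close>

lemma walk_cop_wins:
  assumes "(f, w) \<in> (arcs_ends G)\<^sup>*" "f \<in> verts G" "heads_for w us r" "set rest \<subseteq> verts G"
    and arrived: "\<And>r'. heads_for w us r' \<Longrightarrow> r' \<notin> closed_nbhd G {w} \<Longrightarrow>
       cop_wins G (rev us @ w # rest) r'"
  shows "cop_wins G (rev us @ f # rest) r"
  using assms(1-3)
proof (induction arbitrary: r rule: converse_rtrancl_induct)
  case base
  have "set (rev us @ w # rest) \<subseteq> verts G"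
    using base assms(4) by (auto simp: heads_for_def induced_path_def)
  then show ?case
    using arrived[OF base(2)] cop_wins_near closed_nbhd_mono[of "{w}" "set (rev us @ w # rest)" G]
    by (cases "r \<in> closed_nbhd G {w}") auto
next
  case (step f f')
  have V: "set us \<subseteq> verts G" "f' \<in> verts G"
    using step by (auto simp: heads_for_def induced_path_def)
  have "list_all2 (piece_move G) (rev us @ f # rest) (rev us @ f' # rest)"
    using step(1,4) V assms(4)
    by (intro list_all2_appendI list.rel_intros list_all2_piece_move_refl) (auto simp: piece_move_def)
  moreover have "cop_wins G (rev us @ f' # rest) r'" if "piece_move G r r'" for r'
  proof (cases "r' \<in> closed_nbhd G (set us)")
    case True
    then have "r' \<in> closed_nbhd G (set (rev us @ f' # rest))"
      using closed_nbhd_mono[of "set us" "set (rev us @ f' # rest)" G] by auto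
    then show ?thesis using V assms(4) by (intro cop_wins_near) simp_all
  next
    case False
    then show ?thesis using step.IH[OF V(2)] heads_for_move[OF step.prems(2) that] by blast
  qed
  ultimately show ?case by (rule cop_wins.advance)
qed

text \<open>Induction on the idle cops \<open>rest\<close>: each is sent to \<open>w\<close> and
  becomes the new head of the path; with none left, the path shifts. Reversing the path makes
  \<open>rev us @ w # rest\<close> equal to \<open>rev (w # us) @ rest\<close>, so no cop is
  renumbered.\<close>

lemma heads_for_wins:
  assumes conn: "\<And>u v. u \<in> verts G \<Longrightarrow> v \<in> verts G \<Longrightarrow> (u, v) \<in> (arcs_ends G)\<^sup>*"
    and no_path: "\<And>p. induced_path G p \<Longrightarrow> length p \<noteq> n + 3"
    and no_cycle: "\<And>c. \<not> induced_cycle G (n + 3) c"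
    and "heads_for w us r" "set rest \<subseteq> verts G" "length us + length rest = n"
  shows "cop_wins G (rev us @ rest) r"
  using assms(4-6)
proof (induction rest arbitrary: w us r)
  case Nil
  have n: "length us = n" using Nil(3) by simp
  have "cop_wins G (rev us) r"
    using Nil(1) no_path no_cycle unfolding n[symmetric] by (rule shift_path_wins)
  then show ?case unfolding append_Nil2 .
next
  case (Cons f rest)
  have V: "f \<in> verts G" "set rest \<subseteq> verts G" using Cons.prems(2) by (simp_all only: list.set insert_subset)
  have w: "w \<in> verts G"
    using heads_for_path[OF Cons.prems(1)] by (simp add: induced_path_def)
  have n: "length (w # us) + length rest = n" using Cons.prems(3) by simp
  show ?case
  proof (rule walk_cop_wins[OF conn[OF V(1) w] V(1) Cons.prems(1) V(2)])
    fix r' assume r': "heads_for w us r'" "r' \<notin> closed_nbhd G {w}"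
    then obtain w' where "heads_for w' (w # us) r'" by (rule heads_for_extend)
    from Cons.IH[OF this V(2) n] show "cop_wins G (rev us @ w # rest) r'" by simp
  qed
qed

text \<open>All cops start on one vertex \<open>u\<close>: one of them forms the path
  \<open>[u]\<close>, the others are idle. The first prolongation is the last vertex of
  \<open>N[u]\<close> on a walk to the robber.\<close>

lemma path_cycle_free_cops_win:
  assumes "verts G \<noteq> {}" "n > 0"
    and conn: "\<And>u v. u \<in> verts G \<Longrightarrow> v \<in> verts G \<Longrightarrow> (u, v) \<in> (arcs_ends G)\<^sup>*"
    and no_path: "\<And>p. induced_path G p \<Longrightarrow> length p \<noteq> n + 3"
    and no_cycle: "\<And>c. \<not> induced_cycle G (n + 3) c"
  shows "cops_win G n"
proof -
  obtain u where u: "u \<in> verts G" using assms(1) by blast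
  let ?C = "rev [u] @ replicate (n - 1) u"
  have C: "set ?C \<subseteq> verts G" using u by auto
  have "cop_wins G ?C r" if r: "r \<in> verts G" for r
  proof (cases "r \<in> closed_nbhd G {u}")
    case True
    then show ?thesis using C by (intro cop_wins_near) (auto simp: closed_nbhd_iff)
  next
    case False
    have "(u, r) \<in> (avoiding G {})\<^sup>*" using conn[OF u r] by (simp add: avoiding_def)
    moreover have "r \<notin> {} \<union> closed_nbhd G {u}" "u \<in> closed_nbhd G {u}"
      using False by (auto simp: closed_nbhd_iff)
    ultimately obtain a b where ab: "a \<in> closed_nbhd G {u}" "a \<rightarrow> b"
        "(b, r) \<in> (avoiding G ({} \<union> closed_nbhd G {u}))\<^sup>*"
      by (rule avoiding_boundary)
    \<comment> \<open>Since \<open>b\<close> is not dominated by \<open>u\<close>, its neighbour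
      \<open>a\<close> differs from \<open>u\<close>.\<close>
    then have "b \<notin> closed_nbhd G {u}" using avoiding_rtrancl_notin[OF ab(3)] False by simp
    with ab have "a \<rightarrow> u" using adj_sym by (auto simp: closed_nbhd_iff)
    moreover have "induced_path G [u]" using u adj_irrefl by (auto simp: induced_path_def)
    ultimately have "heads_for a [u] r" using r False ab by (auto simp: heads_for_def)
    then show ?thesis
      using u assms(2) by (intro heads_for_wins[OF conn no_path no_cycle]) auto
  qed
  from cops_winI[OF C this] show ?thesis using assms(2) by simp
qed

end

section \<open>Dominating cycles\<close>

locale claw_free_cycle = graph +
  fixes k :: nat and c :: "nat \<Rightarrow> 'a"
  assumes conn: "\<And>u v. u \<in> verts G \<Longrightarrow> v \<in> verts G \<Longrightarrow> (u, v) \<in> (arcs_ends G)\<^sup>*"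
    and claw_free: "\<And>v a b d. v \<rightarrow> a \<Longrightarrow> v \<rightarrow> b \<Longrightarrow> v \<rightarrow> d \<Longrightarrow> a \<noteq> b \<Longrightarrow> a \<noteq> d \<Longrightarrow> b \<noteq> d \<Longrightarrow>
       a \<rightarrow> b \<or> a \<rightarrow> d \<or> b \<rightarrow> d"
    and path_free: "\<And>p. induced_path G p \<Longrightarrow> length p \<noteq> k"
    and cycle: "induced_cycle G k c"
    and k: "k \<ge> 5"
begin

text \<open>Here and in \<open>cycle_adj\<close>, cycle vertices are located by their distance
  \<open>d < k\<close> from an arbitrary base point \<open>s\<close>, which keeps residues out of
  the later case distinctions.\<close>

lemma cycle_eq: "d < k \<Longrightarrow> c (s + d) = c s \<longleftrightarrow> d = 0"
  using cycle mod_add_left_cancel_nat[of s d k 0] by (simp add: induced_cycle_def)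

lemma cycle_adj:
  assumes "d < k"
  shows "c s \<rightarrow> c (s + d) \<longleftrightarrow> d = 1 \<or> Suc d = k"
proof -
  have "c s \<rightarrow> c (s + d) \<longleftrightarrow> d mod k = 1 mod k \<or> 0 mod k = Suc d mod k"
    using cycle mod_add_left_cancel_nat[of s d k 1] mod_add_left_cancel_nat[of s 0 k "Suc d"]
    by (simp add: induced_cycle_def)
  then show ?thesis using assms k by (auto simp: mod_Suc)
qed

lemma cycle_mod: "c (i mod k) = c i"
  using cycle by (simp add: induced_cycle_def)

text \<open>At least one cycle vertex is left out, so the edge that would close the cycle is
  missing.\<close>

lemma cycle_arc:
  assumes "m < k"
  shows "induced_path G (map (\<lambda>d. c (s + d)) [0..<m])"
proof -
  have ij: "s + i + (j - i) = s + j" "j - i < k" if "i \<le> j" "j < m" for i j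
    using that assms by auto
  have eq: "i = j" if "c (s + i) = c (s + j)" "i \<le> j" "j < m" for i j
    using cycle_eq[OF ij(2), of i j "s + i"] ij(1)[of i j] that by simp
  have adj: "c (s + i) \<rightarrow> c (s + j) \<longleftrightarrow> j = Suc i" if "i \<le> j" "j < m" for i j
    using cycle_adj[OF ij(2), of i j "s + i"] ij(1)[of i j] that assms by auto
  have "c (s + i) \<rightarrow> c (s + j) \<longleftrightarrow> j = Suc i \<or> i = Suc j" if "i < m" "j < m" for i j
    using adj[of i j] adj[of j i] that adj_sym[of "c (s + i)" "c (s + j)"]
    by (cases "i \<le> j") auto
  moreover have "inj_on (\<lambda>d. c (s + d)) {0..<m}"
    by (rule inj_onI) (metis eq atLeastLessThan_iff nat_le_linear)
  moreover have "range c \<subseteq> verts G" using cycle by (simp add: induced_cycle_def)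
  ultimately show ?thesis unfolding induced_path_def by (auto simp: distinct_map)
qed

text \<open>Otherwise \<open>c (i + 1)\<close> is the centre of a claw with leaves
  \<open>c i\<close>, \<open>c (i + 2)\<close> and \<open>v\<close>; as \<open>k \<ge> 5\<close>,
  the first two are neither equal nor adjacent.\<close>

lemma nbr_cycle_step:
  assumes "v \<notin> range c" "v \<rightarrow> c (i + 1)"
  shows "v \<rightarrow> c i \<or> v \<rightarrow> c (i + 2)"
proof -
  have "c (i + 1) \<rightarrow> c i" "c (i + 1) \<rightarrow> c (i + 2)" "c (i + 1) \<rightarrow> v"
    using cycle_adj[of 1 i] cycle_adj[of 1 "i + 1"] k assms(2)
      adj_sym[of "c (i + 1)" "c i"] adj_sym[of v "c (i + 1)"] by simp_all
  moreover have "c i \<noteq> c (i + 2)" "\<not> c i \<rightarrow> c (i + 2)"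
    using cycle_eq[of 2 i] cycle_adj[of 2 i] k by auto
  moreover have "c i \<noteq> v" "c (i + 2) \<noteq> v" using assms(1) by auto
  ultimately have "c i \<rightarrow> v \<or> c (i + 2) \<rightarrow> v"
    using claw_free[of "c (i + 1)" "c i" "c (i + 2)" v] by blast
  then show ?thesis using adj_sym by blast
qed

text \<open>With only two neighbours on the cycle, \<open>v\<close> would form an induced path with all cycle
  vertices but one.\<close>

lemma nbr_cycle_third:
  assumes "v \<notin> range c" "v \<rightarrow> c s" "v \<rightarrow> c (s + 1)"
  obtains d where "2 \<le> d" "d < k" "v \<rightarrow> c (s + d)"
proof -
  have "\<exists>d. 2 \<le> d \<and> d < k \<and> v \<rightarrow> c (s + d)"
  proof (rule ccontr)
    assume no: "\<nexists>d. 2 \<le> d \<and> d < k \<and> v \<rightarrow> c (s + d)"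
    \<comment> \<open>The arc from \<open>c (s + 2)\<close> to \<open>c (s + k - 1)\<close>;
      together with \<open>c (s + 1)\<close> it is the cycle without \<open>c s\<close>.\<close>
    let ?p = "map (\<lambda>d. c (s + 1 + d)) [1..<k - 1]"
    have p: "c (s + 1) # ?p = map (\<lambda>d. c (s + 1 + d)) [0..<k - 1]"
      using k by (simp add: upt_conv_Cons)
    have "induced_path G (c (s + 1) # ?p)" unfolding p using k by (intro cycle_arc) simp
    moreover have "v \<noteq> x \<and> \<not> v \<rightarrow> x" if "x \<in> set ?p" for x
    proof -
      obtain d where d: "1 \<le> d" "d < k - 1" "x = c (s + (d + 1))"
        using \<open>x \<in> set ?p\<close> by auto
      then have "2 \<le> d + 1 \<and> d + 1 < k" by auto
      then show ?thesis using no assms(1) d(3) by blast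
    qed
    ultimately have "induced_path G (v # c (s + 1) # ?p)"
      using assms(3) by (intro induced_path_Cons) auto
    moreover have "length (v # c (s + 1) # ?p) = k" using k by simp
    ultimately show False using path_free by blast
  qed
  with that show thesis by blast
qed

text \<open>There are consecutive neighbours \<open>c s\<close>, \<open>c (s + 1)\<close> and a
  third one \<open>c (s + d)\<close>. For \<open>d = 2\<close> the third is not adjacent to
  \<open>c s\<close>, for larger \<open>d\<close> not to \<open>c (s + 1)\<close>.\<close>

lemma nonadjacent_nbrs_on_cycle:
  assumes "v \<notin> range c" "v \<rightarrow> c j"
  obtains a b where "a \<in> range c" "b \<in> range c" "v \<rightarrow> a" "v \<rightarrow> b" "a \<noteq> b" "\<not> a \<rightarrow> b"
proof -
  have "c (j + k) = c j"
    using cycle_mod[of j] cycle_mod[of "j + k"] by simp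
  \<comment> \<open>The index \<open>j + k - 1\<close> denotes the predecessor of \<open>c j\<close>
    on the cycle even for \<open>j = 0\<close>.\<close>
  then have j: "v \<rightarrow> c (j + k - 1 + 1)" using assms(2) k by simp
  have "v \<rightarrow> c (j + k - 1) \<or> v \<rightarrow> c (j + k - 1 + 1 + 1)"
    using nbr_cycle_step[OF assms(1) j] by simp
  with j obtain s where s: "v \<rightarrow> c s" "v \<rightarrow> c (s + 1)" by blast
  with assms(1) obtain d where d: "2 \<le> d" "d < k" "v \<rightarrow> c (s + d)"
    by (rule nbr_cycle_third)
  show thesis
  proof (cases "d = 2")
    case True
    then have "c s \<noteq> c (s + d)" "\<not> c s \<rightarrow> c (s + d)"
      using d(2) cycle_eq[of d s] cycle_adj[of d s] k by auto
    then show ?thesis using that s(1) d(3) by blast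
  next
    case False
    have "s + 1 + (d - 1) = s + d" "d - 1 < k" using d by auto
    then have "c (s + 1) \<noteq> c (s + d)" "\<not> c (s + 1) \<rightarrow> c (s + d)"
      using False d(1,2) cycle_eq[of "d - 1" "s + 1"] cycle_adj[of "d - 1" "s + 1"] by auto
    then show ?thesis using that s(2) d(3) by blast
  qed
qed

text \<open>Induction along a walk from \<open>c 0\<close>: if \<open>y\<close> is dominated and its
  neighbour \<open>z\<close> is not, then \<open>y\<close>, \<open>z\<close> and two nonadjacent
  neighbours of \<open>y\<close> on the cycle form a claw.\<close>

lemma cycle_dominates:
  assumes "v \<in> verts G"
  shows "v \<in> closed_nbhd G (range c)"
proof -
  have "c 0 \<in> verts G" using cycle by (auto simp: induced_cycle_def)
  from conn[OF this assms] show ?thesis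
  proof (induction rule: rtrancl_induct)
    case base
    show ?case by (simp add: closed_nbhd_iff)
  next
    case (step y z)
    show ?case
    proof (rule ccontr)
      assume z: "z \<notin> closed_nbhd G (range c)"
      then have y: "y \<notin> range c" using step(2) by (auto simp: closed_nbhd_iff)
      then obtain j where "y \<rightarrow> c j" using step.IH adj_sym by (auto simp: closed_nbhd_iff)
      with y obtain a b where ab: "a \<in> range c" "b \<in> range c" "y \<rightarrow> a" "y \<rightarrow> b" "a \<noteq> b" "\<not> a \<rightarrow> b"
        by (rule nonadjacent_nbrs_on_cycle)
      have "a \<noteq> z" "b \<noteq> z" "\<not> a \<rightarrow> z" "\<not> b \<rightarrow> z"
        using ab(1,2) z unfolding closed_nbhd_iff by blast+
      with claw_free[OF ab(3,4) step(2)] ab show False by blast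
    qed
  qed
qed

text \<open>The cycle vertices \<open>1\<close>, \<open>3\<close>, \<open>4\<close> can be spared: an outside vertex seeing \<open>1\<close> sees \<open>0\<close> or
  \<open>2\<close> too, and one seeing only \<open>3\<close> and \<open>4\<close> is excluded by \<open>nbr_cycle_third\<close>.\<close>

definition cop_places :: "'a list" where
  "cop_places = c 0 # c 2 # map c [5..<k]"

lemma cop_places_dominate:
  assumes "v \<in> verts G"
  shows "v \<in> closed_nbhd G (set cop_places)"
proof (rule ccontr)
  assume no: "v \<notin> closed_nbhd G (set cop_places)"
  have places: "c i \<in> set cop_places" if "i < k" "i \<noteq> 1" "i \<noteq> 3" "i \<noteq> 4" for i
  proof -
    have "i = 0 \<or> i = 2 \<or> 5 \<le> i" using that by arith
    then show ?thesis using that by (auto simp: cop_places_def)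
  qed
  \<comment> \<open>For \<open>k = 5\<close> this vertex is \<open>c 0\<close>.\<close>
  have c5: "c 5 \<in> set cop_places"
    using places[of 5] places[of 0] cycle_mod[of 5] k by (cases "k = 5") auto
  have notin: "v \<noteq> c i \<and> \<not> v \<rightarrow> c i" if "c i \<in> set cop_places" for i
    using no that adj_sym by (auto simp: closed_nbhd_iff)
  have no0: "v \<noteq> c 0" "\<not> v \<rightarrow> c 0" and no2: "v \<noteq> c 2" "\<not> v \<rightarrow> c 2"
    and no5: "v \<noteq> c 5" "\<not> v \<rightarrow> c 5"
    using notin[OF places[of 0]] notin[OF places[of 2]] notin[OF c5] k by auto
  have adj: "c i \<rightarrow> c (i + 1)" for i using cycle_adj[of 1 i] k by simp
  \<comment> \<open>The spared vertices are themselves dominated: \<open>c 1\<close> by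
    \<open>c 0\<close>, \<open>c 3\<close> by \<open>c 2\<close> and \<open>c 4\<close> by
    \<open>c 5\<close>.\<close>
  have "v \<noteq> c i" if i: "i < k" for i
  proof
    assume v: "v = c i"
    then consider "i = 1" | "i = 3" | "i = 4" using places[OF i] notin by blast
    then show False
    proof cases
      case 1
      then show ?thesis using v adj[of 0] adj_sym[of "c 0"] no0 by simp
    next
      case 2
      then show ?thesis using v adj[of 2] adj_sym[of "c 2"] no2 by simp
    next
      case 3
      then show ?thesis using v adj[of 4] no5 by simp
    qed
  qed
  then have "v \<noteq> c i" for i using cycle_mod[of i] k by (metis mod_less_divisor gr_zeroI not_numeral_le_zero)
  then have v: "v \<notin> range c" by blast
  obtain j where "v \<rightarrow> c j"
    using cycle_dominates[OF assms] v adj_sym by (auto simp: closed_nbhd_iff)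
  then have i: "j mod k < k" "v \<rightarrow> c (j mod k)" using k by (simp_all add: cycle_mod)
  have n1: "\<not> v \<rightarrow> c 1"
    using nbr_cycle_step[OF v, of 0] no0 no2 by (auto simp: numeral_2_eq_2)
  have "v \<rightarrow> c 3 \<or> v \<rightarrow> c 4"
  proof (rule ccontr)
    assume "\<not> ?thesis"
    with i(2) n1 have "j mod k \<noteq> 1" "j mod k \<noteq> 3" "j mod k \<noteq> 4" by auto
    then show False using places[OF i(1)] notin i(2) by blast
  qed
  \<comment> \<open>Since \<open>v\<close> sees neither \<open>c 2\<close> nor \<open>c 5\<close>,
    seeing one of \<open>c 3\<close> and \<open>c 4\<close> forces the other.\<close>
  moreover have "v \<rightarrow> c 3 \<Longrightarrow> v \<rightarrow> c 4" using nbr_cycle_step[OF v, of 2] no2 by simp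
  moreover have "v \<rightarrow> c 4 \<Longrightarrow> v \<rightarrow> c 3" using nbr_cycle_step[OF v, of 3] no5 by simp
  ultimately have "v \<rightarrow> c 3" "v \<rightarrow> c (3 + 1)" by auto
  with v obtain d where d: "2 \<le> d" "d < k" "v \<rightarrow> c (3 + d)" by (rule nbr_cycle_third)
  \<comment> \<open>Without wrap-around the index is at least \<open>5\<close>, with it below
    \<open>3\<close>; all these places are occupied except \<open>1\<close>, which \<open>n1\<close>
    excludes.\<close>
  have "\<not> v \<rightarrow> c ((3 + d) mod k)"
  proof (cases "3 + d < k")
    case True
    then show ?thesis using d(1) places[of "3 + d"] notin by simp
  next
    case False
    then have "(3 + d) mod k = 3 + d - k" "3 + d - k < 3" using d k by (auto simp: mod_if)
    then show ?thesis using places[of "3 + d - k"] notin[of "3 + d - k"] n1 k by (cases "3 + d - k = 1") simp_all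
  qed
  then show False using d(3) unfolding cycle_mod by blast
qed

lemma claw_free_cycle_cops_win: "cops_win G (k - 3)"
proof -
  have "range c \<subseteq> verts G" using cycle by (simp add: induced_cycle_def)
  then have C: "set cop_places \<subseteq> verts G" by (auto simp: cop_places_def)
  have "cops_win G (length cop_places)"
    using C by (rule cops_winI) (rule cop_wins_near[OF C cop_places_dominate])
  moreover have "length cop_places = k - 3" using k by (simp add: cop_places_def)
  ultimately show ?thesis by simp
qed

end

theorem theorem3:
  fixes G :: "('a, 'b) pre_digraph" and k :: nat
  assumes "k \<ge> 5"
    and "graph G"
    and "Digraph_Component.connected G"
    and "\<not> (\<exists>H. induced_subgraph H G \<and> path_graph k H)"
    and "\<not> (\<exists>H. induced_subgraph H G \<and> complete_bipartite_digraph 1 3 H)"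
  shows "cop_number G \<le> k - 3"
proof -
  interpret graph G by fact
  have sc: "strongly_connected G"
    using sym_arcs assms(3) by (rule symmetric_connected_imp_strongly_connected)
  then have conn: "(u, v) \<in> (arcs_ends G)\<^sup>*" if "u \<in> verts G" "v \<in> verts G" for u v
    using that by (auto simp: strongly_connected_def reachable_conv)
  have path: "length p \<noteq> k" if "induced_path G p" for p
    using induced_path_imp_path_graph[OF that] assms(4) by blast
  have "cops_win G (k - 3)"
  proof (cases "\<exists>c. induced_cycle G k c")
    case True
    then obtain c where "induced_cycle G k c" ..
    then interpret claw_free_cycle G k c
      using conn path assms(1) claw_free_adj[OF assms(5)] by unfold_locales blast+
    show ?thesis by (rule claw_free_cycle_cops_win)
  next
    case False
    \<comment> \<open>The chase with \<open>n\<close> cops forbids induced paths and cycles on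
      \<open>n + 3\<close> vertices, here with \<open>n = k - 3\<close>.\<close>
    have "k - 3 + 3 = k" using assms(1) by simp
    with False path sc assms(1) conn show ?thesis
      by (intro path_cycle_free_cops_win) (auto simp: strongly_connected_def)
  qed
  then show ?thesis unfolding cop_number_def by (rule Least_le)
qed

end
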